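(* Let $S$ be a subfit and round $\vee$-semilattice. Then for all $p,q\in S$, $$p\prec q\quad\Leftrightarrow\quad\mathrm{cl}(\widehat{S}_p)\subseteq\widehat{S}_q,$$ where $\mathrm{cl}$ denotes closure in the spectrum $\widehat{S}$.
   Context: A $\vee$-semilattice is a non-empty poset in which any two elements $p,q$ have a supremum $p\vee q$. A grill in a $\vee$-semilattice $S$ is a subset $G\subseteq S$ such that $p\vee q\geq g\in G$ implies $p\in G$ or $q\in G$. The spectrum $\widehat{S}$ is the set of all proper minimal non-empty grills of $S$, i.e. grills $G$ with $\emptyset\neq G\neq S$ such that no non-empty grill is strictly contained in $G$. It carries the topology generated by the subbasis $(\widehat{S}_p)_{p\in S}$, where $\widehat{S}_p=\{G\in\widehat{S}:p\in G\}$. A non-empty finite $F\subseteq S$ is far if for all $p,q\in S$: if $p\leq q\vee f$ for all $f\in F$, then $p\leq q$. The rather below relation is defined by: $p\prec q$ iff for all $s\in S$ with $s\nleq q$ there is a finite $F\subseteq S$ such that $F\cup\{p\}$ is far and $s\leq f\vee q$ for all $f\in F$. $S$ is round if for every $p\in S$ there is $q\in S$ with $p\prec q$. $S$ is subfit if for all $p,q\in S$: $p\nleq q$ iff for every $p'\geq p$ there is $q'\geq q$ with $p\vee q'\geq p'$ and $p'\nleq q'$. *)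

theory Defs
  imports "HOL-Analysis.Analysis"
begin

text \<open>
  A join-semilattice is a type of class \<open>semilattice_sup\<close>, with \<open>\<squnion>\<close> written \<open>sup\<close>.
  Non-emptiness of the carrier is automatic, and \<open>UNIV\<close> plays the role of \<open>S\<close>.
  No bottom or top element is assumed.
\<close>

definition grill :: "'a::semilattice_sup set \<Rightarrow> bool" where
  "grill G \<longleftrightarrow> (\<forall>p q g. g \<in> G \<and> g \<le> sup p q \<longrightarrow> p \<in> G \<or> q \<in> G)"

text \<open>Minimality is among all non-empty grills, \<open>UNIV\<close> included; properness is a separate condition.\<close>

definition spectrum :: "'a::semilattice_sup set set" where
  "spectrum = {G. grill G \<and> G \<noteq> {} \<and> G \<noteq> UNIV \<and> \<not> (\<exists>H. grill H \<and> H \<noteq> {} \<and> H \<subset> G)}"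

definition spectrum_at :: "'a::semilattice_sup \<Rightarrow> 'a set set" where
  "spectrum_at p = {G \<in> spectrum. p \<in> G}"

text \<open>
  The underlying set of \<open>topology_generated_by\<close> is the union of the subbasis, which here is
  all of \<open>spectrum\<close> because its members are non-empty (see \<open>topspace_spectrum_topology\<close>).
\<close>

definition spectrum_topology :: "'a::semilattice_sup set topology" where
  "spectrum_topology = topology_generated_by (range spectrum_at)"

lemma topspace_spectrum_topology:
  "topspace (spectrum_topology :: 'a::semilattice_sup set topology) = spectrum"
  by (auto simp: spectrum_topology_def topology_generated_by_topspace spectrum_at_def spectrum_def)

definition far :: "'a::semilattice_sup set \<Rightarrow> bool" where
  "far F \<longleftrightarrow> finite F \<and> F \<noteq> {} \<and> (\<forall>p q. (\<forall>f\<in>F. p \<le> sup q f) \<longrightarrow> p \<le> q)"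

text \<open>The finite set \<open>F\<close> below may be empty.\<close>

definition rather_below :: "'a::semilattice_sup \<Rightarrow> 'a \<Rightarrow> bool" where
  "rather_below p q \<longleftrightarrow>
     (\<forall>s. \<not> s \<le> q \<longrightarrow> (\<exists>F. finite F \<and> far (F \<union> {p}) \<and> (\<forall>f\<in>F. s \<le> sup f q)))"

text \<open>
  Roundness and subfitness are properties of the whole semilattice; the argument of type
  \<open>'a itself\<close> only names it, as in \<open>subfit TYPE('a)\<close>.
\<close>

definition round_semilattice :: "'a::semilattice_sup itself \<Rightarrow> bool" where
  "round_semilattice _ \<longleftrightarrow> (\<forall>p::'a. \<exists>q. rather_below p q)"

definition subfit :: "'a::semilattice_sup itself \<Rightarrow> bool" where
  "subfit _ \<longleftrightarrow>
     (\<forall>p q::'a. \<not> p \<le> q \<longleftrightarrow> (\<forall>p'\<ge>p. \<exists>q'\<ge>q. p' \<le> sup p q' \<and> \<not> p' \<le> q'))"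

end

theory Submission
  imports Defs
begin

text \<open>
  Complements of grills are ideals, so points of the spectrum are maximal proper ideals.

  A maximal ideal that misses every element of \<open>F\<close> contradicts farness of \<open>F\<close>,
  which gives the implication from left to right.

  Conversely, roundness extends every proper ideal to a maximal one: if \<open>s \<prec> t\<close>, an ideal maximal
  among those avoiding \<open>s\<close> meets every \<open>F\<close> for which \<open>F \<union> {s}\<close> is far, and an ideal above it that is
  maximal among those avoiding \<open>t\<close> is then already maximal proper. With subfitness the points
  of the spectrum separate any \<open>s\<close> from \<open>q\<close> unless \<open>s \<le> q\<close>. Now call a finite set \<open>F\<close> admissible if no point contains
  \<open>F \<union> {p}\<close>. If no admissible \<open>F\<close> had \<open>s \<le> f \<squnion> q\<close> for all \<open>f \<in> F\<close>, a Zorn argument would give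
  a maximal ideal containing \<open>q\<close> and meeting every admissible set; its complement would lie in
  the closure of the points containing \<open>p\<close> but would not contain \<open>q\<close>.
\<close>

section \<open>Ideals of a join-semilattice\<close>

text \<open>A single equivalence covers downward closure and closure under joins, so that
  complementation turns it into \<open>grill_iff\<close>. The whole semilattice counts as an
  ideal.\<close>

definition ideal :: "'a::semilattice_sup set \<Rightarrow> bool" where
  "ideal K \<longleftrightarrow> K \<noteq> {} \<and> (\<forall>x y. sup x y \<in> K \<longleftrightarrow> x \<in> K \<and> y \<in> K)"

text \<open>For an ideal \<open>K\<close> this is the least ideal containing \<open>K\<close> and
  \<open>x\<close>.\<close>

definition ideal_sup :: "'a::semilattice_sup set \<Rightarrow> 'a \<Rightarrow> 'a set" where
  "ideal_sup K x = {y. \<exists>k\<in>K. y \<le> sup k x}"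

lemma ideal_downD: "ideal K \<Longrightarrow> y \<in> K \<Longrightarrow> x \<le> y \<Longrightarrow> x \<in> K"
  unfolding ideal_def by (metis sup.absorb2)

lemma ideal_supI: "ideal K \<Longrightarrow> x \<in> K \<Longrightarrow> y \<in> K \<Longrightarrow> sup x y \<in> K"
  by (simp add: ideal_def)

lemma ideal_finite_bound:
  assumes "ideal K" "finite F" "F \<subseteq> K"
  shows "\<exists>k\<in>K. \<forall>f\<in>F. f \<le> k"
  using assms(2,3)
proof (induction F)
  case empty
  then show ?case using assms(1) by (auto simp: ideal_def)
next
  case (insert x F)
  then obtain k where "k \<in> K" "\<forall>f\<in>F. f \<le> k" by auto
  then show ?case using insert.prems assms(1)
    by (intro bexI[of _ "sup k x"]) (auto intro: ideal_supI le_supI1)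
qed

text \<open>Directedness of \<open>K\<close> and finiteness of \<open>F\<close> replace separate
  witnesses by one \<open>k\<close>, the form in which farness can be applied.\<close>

lemma ideal_uniform_bound:
  assumes "ideal K" "finite F" "\<And>f. f \<in> F \<Longrightarrow> a \<in> ideal_sup K f"
  shows "\<exists>k\<in>K. \<forall>f\<in>F. a \<le> sup k f"
proof -
  obtain j where j: "\<And>f. f \<in> F \<Longrightarrow> j f \<in> K \<and> a \<le> sup (j f) f"
    using assms(3) unfolding ideal_sup_def by (simp add: Bex_def) metis
  obtain k where "k \<in> K" "\<forall>x\<in>j ` F. x \<le> k"
    using ideal_finite_bound[OF assms(1), of "j ` F"] assms(2) j by auto
  then show ?thesis
    using j by (meson imageI order_trans order_refl sup_mono)
qed

lemma subset_ideal_sup: "K \<subseteq> ideal_sup K x"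
  by (auto simp: ideal_sup_def intro: sup_ge1)

lemma mem_ideal_sup: "ideal K \<Longrightarrow> x \<in> ideal_sup K x"
  by (auto simp: ideal_sup_def ideal_def)

lemma ideal_ideal_sup:
  assumes "ideal K" shows "ideal (ideal_sup K x)"
  unfolding ideal_def
proof (intro conjI allI iffI)
  show "ideal_sup K x \<noteq> {}"
    using assms mem_ideal_sup by blast
next
  fix a b assume "a \<in> ideal_sup K x \<and> b \<in> ideal_sup K x"
  then obtain k l where "k \<in> K" "l \<in> K" "a \<le> sup k x" "b \<le> sup l x"
    by (auto simp: ideal_sup_def)
  then have "sup a b \<le> sup (sup k l) x"
    by (meson le_supI order_trans order_refl sup_ge1 sup_ge2 sup_mono)
  then show "sup a b \<in> ideal_sup K x"
    using \<open>k \<in> K\<close> \<open>l \<in> K\<close> assms by (auto simp: ideal_sup_def intro: ideal_supI)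
qed (auto simp: ideal_sup_def)

lemma ideal_sup_absorb:
  assumes "ideal K" "x \<in> K" shows "ideal_sup K x = K"
proof
  show "ideal_sup K x \<subseteq> K"
    using ideal_downD[OF assms(1)] ideal_supI[OF assms(1) _ assms(2)] by (auto simp: ideal_sup_def)
qed (rule subset_ideal_sup)

lemma ideal_sup_sup: "ideal_sup (ideal_sup K x) y \<subseteq> ideal_sup K (sup x y)"
proof
  fix a assume "a \<in> ideal_sup (ideal_sup K x) y"
  then obtain k j where "k \<in> K" "j \<le> sup k x" "a \<le> sup j y" by (auto simp: ideal_sup_def)
  then have "a \<le> sup k (sup x y)" by (metis order_trans order_refl sup_assoc sup_mono)
  then show "a \<in> ideal_sup K (sup x y)" using \<open>k \<in> K\<close> by (auto simp: ideal_sup_def)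
qed

lemma ideal_Union_chain:
  assumes "C \<noteq> {}" "\<And>K. K \<in> C \<Longrightarrow> ideal K" "subset.chain A C"
  shows "ideal (\<Union>C)"
  unfolding ideal_def
proof (intro conjI allI iffI)
  show "\<Union>C \<noteq> {}" using assms(1,2) by (auto simp: ideal_def)
next
  fix x y assume "x \<in> \<Union>C \<and> y \<in> \<Union>C"
  then obtain K L where "K \<in> C" "L \<in> C" "x \<in> K" "y \<in> L" by auto
  moreover have "K \<subseteq> L \<or> L \<subseteq> K"
    using assms(3) \<open>K \<in> C\<close> \<open>L \<in> C\<close> by (auto simp: subset_chain_def)
  ultimately show "sup x y \<in> \<Union>C"
    using assms(2) ideal_supI by blast
qed (use assms(2) in \<open>auto simp: ideal_def\<close>)

section \<open>Extension of ideals by Zorn's lemma\<close>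

text \<open>Zorn's lemma runs over ideals \<open>M\<close> such that no \<open>F\<close> has
  \<open>s\<close> in \<open>ideal_sup M f\<close> for all its elements \<open>f\<close>. This
  condition passes to unions of chains because each \<open>F\<close> is finite. Closure of
  \<open>\<F>\<close> under the products in \<open>prod\<close> then makes a maximal such ideal meet
  every \<open>F\<close>.\<close>

lemma ideal_extension:
  fixes s :: "'a::semilattice_sup"
  assumes K: "ideal K"
    and fin: "\<And>F. F \<in> \<F> \<Longrightarrow> finite F"
    and ne: "\<F> \<noteq> {}"
    and prod: "\<And>F \<phi>. F \<in> \<F> \<Longrightarrow> (\<And>f. f \<in> F \<Longrightarrow> \<phi> f \<in> \<F>) \<Longrightarrow> (\<Union>f\<in>F. sup f ` \<phi> f) \<in> \<F>"
    and good: "\<And>F. F \<in> \<F> \<Longrightarrow> \<exists>f\<in>F. s \<notin> ideal_sup K f"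
  obtains M where "ideal M" "K \<subseteq> M" "s \<notin> M" "\<And>x. x \<notin> M \<Longrightarrow> s \<in> ideal_sup M x"
    "\<And>F. F \<in> \<F> \<Longrightarrow> F \<inter> M \<noteq> {}"
proof -
  define A where "A = {M. ideal M \<and> K \<subseteq> M \<and> (\<forall>F\<in>\<F>. \<exists>f\<in>F. s \<notin> ideal_sup M f)}"
  have "\<exists>M\<in>A. \<forall>X\<in>A. M \<subseteq> X \<longrightarrow> X = M"
  proof (rule subset_Zorn_nonempty)
    show "A \<noteq> {}" using K good by (auto simp: A_def)
  next
    fix C assume C: "C \<noteq> {}" "subset.chain A C"
    then have CA: "C \<subseteq> A" by (simp add: subset_chain_def)
    have I: "ideal (\<Union>C)"
      by (rule ideal_Union_chain[OF C(1) _ C(2)]) (use CA in \<open>auto simp: A_def\<close>)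
    have "\<exists>f\<in>F. s \<notin> ideal_sup (\<Union>C) f" if F: "F \<in> \<F>" for F
    proof (rule ccontr)
      assume "\<not> ?thesis"
      then obtain k where "k \<in> \<Union>C" and k: "\<forall>f\<in>F. s \<le> sup k f"
        using ideal_uniform_bound[OF I fin[OF F], of s] by auto
      then obtain M where "M \<in> C" "k \<in> M" by auto
      then have "\<forall>f\<in>F. s \<in> ideal_sup M f" using k by (auto simp: ideal_sup_def)
      then show False using \<open>M \<in> C\<close> CA F unfolding A_def by blast
    qed
    then show "\<Union>C \<in> A" using I C(1) CA unfolding A_def by blast
  qed
  then obtain M where MA: "M \<in> A" and max: "\<And>X. X \<in> A \<Longrightarrow> M \<subseteq> X \<Longrightarrow> X = M" by blast
  have M: "ideal M" "K \<subseteq> M" and Mgood: "\<And>F. F \<in> \<F> \<Longrightarrow> \<exists>f\<in>F. s \<notin> ideal_sup M f"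
    using MA by (auto simp: A_def)
  have bad: "\<exists>F\<in>\<F>. \<forall>f\<in>F. s \<in> ideal_sup M (sup x f)" if "x \<notin> M" for x
  proof -
    have "ideal_sup M x \<notin> A"
      using max[of "ideal_sup M x"] subset_ideal_sup mem_ideal_sup M(1) that by blast
    moreover have "K \<subseteq> ideal_sup M x" using M(2) subset_ideal_sup by blast
    ultimately have "\<exists>F\<in>\<F>. \<forall>f\<in>F. s \<in> ideal_sup (ideal_sup M x) f"
      using ideal_ideal_sup[OF M(1)] by (simp add: A_def)
    then show ?thesis by (meson ideal_sup_sup subsetD)
  qed
  have meet: "F \<inter> M \<noteq> {}" if F: "F \<in> \<F>" for F
  proof
    assume "F \<inter> M = {}"
    \<comment> \<open>Adjoining any \<open>x\<close> in \<open>F\<close> to \<open>M\<close>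
      destroys goodness through some \<open>\<phi> x\<close>. The product of these sets over
      \<open>F\<close> belongs to \<open>\<F>\<close> again and contradicts goodness of
      \<open>M\<close> itself.\<close>
    then have "\<forall>x\<in>F. \<exists>F'\<in>\<F>. \<forall>f\<in>F'. s \<in> ideal_sup M (sup x f)" using bad by blast
    then obtain \<phi> where \<phi>: "\<And>x. x \<in> F \<Longrightarrow> \<phi> x \<in> \<F> \<and> (\<forall>f\<in>\<phi> x. s \<in> ideal_sup M (sup x f))"
      by metis
    from Mgood[OF prod[OF F, of \<phi>]] \<phi> show False by blast
  qed
  show thesis
  proof
    show "ideal M" "K \<subseteq> M" by (fact M)+
    show "s \<notin> M" using ne Mgood subset_ideal_sup by blast
    show "F \<inter> M \<noteq> {}" if "F \<in> \<F>" for F using meet[OF that] .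
    show "s \<in> ideal_sup M x" if x: "x \<notin> M" for x
    proof -
      obtain F where F: "F \<in> \<F>" "\<forall>f\<in>F. s \<in> ideal_sup M (sup x f)" using bad[OF x] by blast
      \<comment> \<open>The set that fails for \<open>x\<close> meets \<open>M\<close>, and an
        \<open>f\<close> in \<open>M\<close> is absorbed, leaving \<open>x\<close> alone.\<close>
      then obtain f where f: "f \<in> M" "s \<in> ideal_sup M (sup x f)" using meet by blast
      then obtain k where "k \<in> M" "s \<le> sup (sup k f) x"
        by (auto simp: ideal_sup_def ac_simps)
      then show ?thesis using f(1) M(1) by (auto simp: ideal_sup_def intro: ideal_supI)
    qed
  qed
qed

text \<open>For the family of singletons of \<open>K\<close>, goodness just says
  \<open>s \<notin> K\<close>, and products are joins in \<open>K\<close>.\<close>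

lemma ideal_extension_avoiding:
  fixes s :: "'a::semilattice_sup"
  assumes "ideal K" "s \<notin> K"
  obtains M where "ideal M" "K \<subseteq> M" "s \<notin> M" "\<And>x. x \<notin> M \<Longrightarrow> s \<in> ideal_sup M x"
proof (rule ideal_extension[OF assms(1), of "(\<lambda>k. {k}) ` K" s])
  note extend = that
  show "(\<lambda>k. {k}) ` K \<noteq> {}" using assms(1) by (simp add: ideal_def)
  show "(\<Union>f\<in>F. sup f ` \<phi> f) \<in> (\<lambda>k. {k}) ` K"
    if F: "F \<in> (\<lambda>k. {k}) ` K" and \<phi>: "\<And>f. f \<in> F \<Longrightarrow> \<phi> f \<in> (\<lambda>k. {k}) ` K" for F \<phi>
  proof -
    obtain k where k: "k \<in> K" "F = {k}" using F by blast
    then obtain l where "l \<in> K" "\<phi> k = {l}" using \<phi>[of k] by blast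
    then show ?thesis using k ideal_supI[OF assms(1)] by auto
  qed
  show thesis if "ideal M" "K \<subseteq> M" "s \<notin> M" "\<And>x. x \<notin> M \<Longrightarrow> s \<in> ideal_sup M x" for M
    using extend that by blast
qed (use assms in \<open>auto simp: ideal_sup_absorb\<close>)

section \<open>Grills, ideals and points of the spectrum\<close>

lemma grill_iff:
  "grill G \<longleftrightarrow> (\<forall>x y. sup x y \<in> G \<longleftrightarrow> x \<in> G \<or> y \<in> G)"
proof
  assume G: "grill G"
  then have "y \<in> G" if "x \<in> G" "x \<le> y" for x y
    using that unfolding grill_def by (metis sup_idem)
  then show "\<forall>x y. sup x y \<in> G \<longleftrightarrow> x \<in> G \<or> y \<in> G"
    using G unfolding grill_def by (meson order_refl sup_ge1 sup_ge2)
next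
  assume "\<forall>x y. sup x y \<in> G \<longleftrightarrow> x \<in> G \<or> y \<in> G"
  then show "grill G" unfolding grill_def by (metis sup.absorb2)
qed

lemma ideal_Compl_iff: "ideal (- G) \<longleftrightarrow> grill G \<and> G \<noteq> UNIV"
proof -
  have "- G \<noteq> {} \<longleftrightarrow> G \<noteq> UNIV" by auto
  then show ?thesis unfolding ideal_def grill_iff Compl_iff by blast
qed

text \<open>A non-empty grill strictly inside \<open>G\<close> is the complement of a proper ideal
  strictly above \<open>- G\<close>, so it suffices to test the ideals generated by
  \<open>- G\<close> and one element of \<open>G\<close>.\<close>

lemma spectrum_iff:
  "G \<in> spectrum \<longleftrightarrow> ideal (- G) \<and> G \<noteq> {} \<and> (\<forall>x\<in>G. ideal_sup (- G) x = UNIV)"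
proof
  assume G: "G \<in> spectrum"
  then have I: "ideal (- G)" "G \<noteq> {}" by (auto simp: spectrum_def ideal_Compl_iff)
  moreover have "ideal_sup (- G) x = UNIV" if "x \<in> G" for x
  proof (rule ccontr)
    assume "ideal_sup (- G) x \<noteq> UNIV"
    moreover have "grill (- ideal_sup (- G) x)"
      using ideal_ideal_sup[OF I(1), of x] ideal_Compl_iff[of "- ideal_sup (- G) x"] by simp
    moreover have "- ideal_sup (- G) x \<subset> G"
      using subset_ideal_sup[of "- G" x] mem_ideal_sup[OF I(1), of x] that by blast
    ultimately show False using G unfolding spectrum_def by blast
  qed
  ultimately show "ideal (- G) \<and> G \<noteq> {} \<and> (\<forall>x\<in>G. ideal_sup (- G) x = UNIV)" by blast
next
  assume G: "ideal (- G) \<and> G \<noteq> {} \<and> (\<forall>x\<in>G. ideal_sup (- G) x = UNIV)"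
  have False if H: "grill H" "H \<noteq> {}" "H \<subset> G" for H
  proof -
    obtain x h where "x \<in> G" "x \<notin> H" "h \<in> H" using H by blast
    then have "h \<in> ideal_sup (- G) x" using G by blast
    then obtain k where "k \<notin> G" "h \<le> sup k x" by (auto simp: ideal_sup_def)
    then show False using H \<open>h \<in> H\<close> \<open>x \<notin> H\<close> unfolding grill_def by blast
  qed
  then show "G \<in> spectrum" using G by (auto simp: spectrum_def ideal_Compl_iff)
qed

lemma spectrum_sup_iff: "G \<in> spectrum \<Longrightarrow> sup x y \<in> G \<longleftrightarrow> x \<in> G \<or> y \<in> G"
  by (simp add: spectrum_def grill_iff)

lemma spectrum_upD: "G \<in> spectrum \<Longrightarrow> x \<in> G \<Longrightarrow> x \<le> y \<Longrightarrow> y \<in> G"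
  by (metis spectrum_sup_iff sup.absorb2)

text \<open>Maximality of \<open>- G\<close> puts any \<open>a\<close> of \<open>G\<close> in the
  ideal generated by \<open>- G\<close> and each \<open>f\<close>. With a uniform bound
  \<open>k\<close> outside \<open>G\<close>, farness gives \<open>a \<le> k\<close>, against upward
  closure of \<open>G\<close>.\<close>

lemma far_not_subset_spectrum:
  assumes "far F" "G \<in> spectrum"
  shows "\<not> F \<subseteq> G"
proof
  assume FG: "F \<subseteq> G"
  have G: "ideal (- G)" using assms(2) spectrum_iff by blast
  obtain a where a: "a \<in> G" using assms(2) spectrum_iff by blast
  have "finite F" using assms(1) by (simp add: far_def)
  moreover have "a \<in> ideal_sup (- G) f" if "f \<in> F" for f
    using assms(2) FG that spectrum_iff by blast
  ultimately obtain k where "k \<in> - G" "\<forall>f\<in>F. a \<le> sup k f"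
    using ideal_uniform_bound[OF G] by blast
  then show False using assms a spectrum_upD unfolding far_def by blast
qed

lemma rather_below_imp_le:
  assumes "rather_below p q" shows "p \<le> q"
proof (rule ccontr)
  assume "\<not> p \<le> q"
  \<comment> \<open>The test element is \<open>p\<close> itself: the bound holds trivially at
    \<open>f = p\<close> too, so farness yields \<open>p \<le> q\<close>.\<close>
  then obtain F where "far (F \<union> {p})" "\<forall>f\<in>F. p \<le> sup f q"
    using assms unfolding rather_below_def by blast
  then show False using \<open>\<not> p \<le> q\<close> unfolding far_def by (metis Un_iff singletonD sup.commute sup.cobounded1)
qed

section \<open>Points obtained from roundness and subfitness\<close>

text \<open>If \<open>F\<close> missed \<open>M\<close>, adjoining any element of
  \<open>F \<union> {s}\<close> would produce \<open>t\<close>, and farness would put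
  \<open>t\<close> into \<open>M\<close>.\<close>

lemma maximal_avoiding_meets:
  assumes M: "ideal M" "t \<notin> M" "\<And>x. x \<notin> M \<Longrightarrow> t \<in> ideal_sup M x"
    and s: "s \<notin> M" and far: "far (F \<union> {s})"
  shows "F \<inter> M \<noteq> {}"
proof
  assume "F \<inter> M = {}"
  then have "\<And>f. f \<in> F \<union> {s} \<Longrightarrow> t \<in> ideal_sup M f" using M(3) s by blast
  moreover have "finite (F \<union> {s})" using far by (simp add: far_def)
  ultimately obtain k where "k \<in> M" "\<forall>f\<in>F \<union> {s}. t \<le> sup k f"
    using ideal_uniform_bound[OF M(1)] by blast
  then have "t \<le> k" using far unfolding far_def by blast
  then show False using M(2) \<open>k \<in> M\<close> ideal_downD[OF M(1)] by blast
qed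

text \<open>For \<open>w\<close> not below \<open>t\<close>, the relation
  \<open>rather_below s t\<close> supplies a set meeting \<open>N\<close> at some \<open>f\<close>
  with \<open>w \<le> sup f t\<close>; so every ideal containing \<open>N\<close> and
  \<open>t\<close> contains \<open>w\<close>.\<close>

lemma maximal_avoiding_in_spectrum:
  assumes st: "rather_below s t"
    and N: "ideal N" "t \<notin> N" "\<And>x. x \<notin> N \<Longrightarrow> t \<in> ideal_sup N x"
    and meets: "\<And>F. far (F \<union> {s}) \<Longrightarrow> F \<inter> N \<noteq> {}"
  shows "- N \<in> spectrum"
proof -
  have "w \<in> ideal_sup N x" if x: "x \<notin> N" for w x
  proof (cases "w \<le> t")
    case True
    then show ?thesis using N(1,3) x ideal_downD ideal_ideal_sup by blast
  next
    case False
    then obtain F where F: "far (F \<union> {s})" "\<forall>f\<in>F. w \<le> sup f t"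
      using st unfolding rather_below_def by blast
    then obtain f where "f \<in> N" "w \<le> sup f t" using meets by blast
    moreover have "sup f t \<in> ideal_sup N x"
      using \<open>f \<in> N\<close> N(1,3) x subset_ideal_sup ideal_ideal_sup ideal_supI by blast
    ultimately show ?thesis using N(1) ideal_downD ideal_ideal_sup by blast
  qed
  then show ?thesis using N unfolding spectrum_iff by auto
qed

lemma round_ideal_subset_spectrum:
  fixes K :: "'a::semilattice_sup set"
  assumes round: "round_semilattice TYPE('a)" and K: "ideal K" "K \<noteq> UNIV"
  obtains G where "G \<in> spectrum" "K \<inter> G = {}"
proof -
  obtain s where "s \<notin> K" using K by blast
  \<comment> \<open>The final ideal \<open>N\<close> need only avoid \<open>t\<close> and may
    contain \<open>s\<close>. The meeting property is therefore secured for \<open>M\<close>, which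
    misses \<open>s\<close>, and inherited by \<open>N\<close>.\<close>
  then obtain M where M: "ideal M" "K \<subseteq> M" "s \<notin> M" "\<And>x. x \<notin> M \<Longrightarrow> s \<in> ideal_sup M x"
    using ideal_extension_avoiding[OF K(1)] by metis
  obtain t where st: "rather_below s t" using round by (auto simp: round_semilattice_def)
  have "t \<notin> M" using rather_below_imp_le[OF st] M ideal_downD by blast
  then obtain N where N: "ideal N" "M \<subseteq> N" "t \<notin> N" "\<And>x. x \<notin> N \<Longrightarrow> t \<in> ideal_sup N x"
    using ideal_extension_avoiding[OF M(1)] by metis
  have "- N \<in> spectrum"
    by (rule maximal_avoiding_in_spectrum[OF st N(1,3,4)])
      (use maximal_avoiding_meets[OF M(1,3,4,3)] N(2) in blast)+
  then show thesis using that M(2) N(2) by blast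
qed

lemma spectrum_separates:
  fixes p q :: "'a::semilattice_sup"
  assumes subfit: "subfit TYPE('a)" and round: "round_semilattice TYPE('a)" and pq: "\<not> p \<le> q"
  obtains G where "G \<in> spectrum" "p \<in> G" "q \<notin> G"
proof -
  obtain t where t: "rather_below p t" using round by (auto simp: round_semilattice_def)
  \<comment> \<open>Subfitness is used with \<open>p' = t\<close>. An ideal containing
    \<open>q'\<close> but not \<open>t\<close> must miss \<open>p\<close>, so one extension avoiding
    \<open>t\<close> suffices.\<close>
  obtain q' where q': "q \<le> q'" "t \<le> sup p q'" "\<not> t \<le> q'"
    using subfit pq rather_below_imp_le[OF t] unfolding subfit_def by blast
  have "ideal {..q'}" by (auto simp: ideal_def)
  then obtain N where N: "ideal N" "{..q'} \<subseteq> N" "t \<notin> N" "\<And>x. x \<notin> N \<Longrightarrow> t \<in> ideal_sup N x"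
    using ideal_extension_avoiding[of "{..q'}" t] q'(3) by auto
  have "p \<notin> N" using N(1-3) q'(2) ideal_downD ideal_supI by (metis atMost_iff order_refl subsetD)
  have "- N \<in> spectrum"
    by (rule maximal_avoiding_in_spectrum[OF t N(1,3,4) maximal_avoiding_meets[OF N(1,3,4) \<open>p \<notin> N\<close>]])
  then show thesis using that \<open>p \<notin> N\<close> N(2) q'(1) by auto
qed

text \<open>Converse to \<open>far_not_subset_spectrum\<close>: a point separating a counterexample
  \<open>a\<close>, \<open>b\<close> to farness contains all of \<open>F\<close>.\<close>

lemma farI_spectrum:
  fixes F :: "'a::semilattice_sup set"
  assumes "subfit TYPE('a)" "round_semilattice TYPE('a)"
    and "finite F" "F \<noteq> {}" and nosub: "\<And>G. G \<in> spectrum \<Longrightarrow> \<not> F \<subseteq> G"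
  shows "far F"
  unfolding far_def
proof (intro conjI allI impI)
  fix a b assume ab: "\<forall>f\<in>F. a \<le> sup b f"
  show "a \<le> b"
  proof (rule ccontr)
    assume "\<not> a \<le> b"
    then obtain G where G: "G \<in> spectrum" "a \<in> G" "b \<notin> G"
      using spectrum_separates assms(1,2) by blast
    then have "F \<subseteq> G" using ab spectrum_upD spectrum_sup_iff by blast
    then show False using nosub G(1) by blast
  qed
qed (use assms in auto)

section \<open>Basic open sets and closure in the spectrum\<close>

text \<open>Finite sets index a base: intersecting open sets corresponds to uniting the index
  sets.\<close>

lemma openin_spectrum_topology_finite:
  assumes "openin spectrum_topology T" "G \<in> T"
  shows "\<exists>F. finite F \<and> F \<subseteq> G \<and> (\<forall>H\<in>spectrum. F \<subseteq> H \<longrightarrow> H \<in> T)"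
proof -
  have "generate_topology_on (range spectrum_at) T"
    using assms(1) by (simp add: spectrum_topology_def openin_topology_generated_by_iff)
  then show ?thesis using assms(2)
  proof (induction T)
    case (Int A B)
    then obtain F F' where "finite F" "F \<subseteq> G" "\<forall>H\<in>spectrum. F \<subseteq> H \<longrightarrow> H \<in> A"
      "finite F'" "F' \<subseteq> G" "\<forall>H\<in>spectrum. F' \<subseteq> H \<longrightarrow> H \<in> B" by auto
    then show ?case by (intro exI[of _ "F \<union> F'"]) auto
  next
    case (UN \<U>)
    then show ?case by (meson Union_iff)
  next
    case (Basis A)
    then obtain x where "A = spectrum_at x" by blast
    with Basis show ?case by (intro exI[of _ "{x}"]) (auto simp: spectrum_at_def)
  qed simp
qed

lemma openin_spectrum_superset:
  assumes "finite F"
  shows "openin spectrum_topology {G \<in> spectrum. F \<subseteq> G}"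
  using assms
proof (induction F)
  case empty
  show ?case using openin_topspace[of spectrum_topology] by (simp add: topspace_spectrum_topology)
next
  case (insert x F)
  have "openin spectrum_topology (spectrum_at x)"
    unfolding spectrum_topology_def by (rule topology_generated_by_Basis) simp
  with insert.IH have "openin spectrum_topology (spectrum_at x \<inter> {G \<in> spectrum. F \<subseteq> G})"
    by blast
  moreover have "{G \<in> spectrum. insert x F \<subseteq> G} = spectrum_at x \<inter> {G \<in> spectrum. F \<subseteq> G}"
    by (auto simp: spectrum_at_def)
  ultimately show ?case by simp
qed

lemma in_closure_spectrum_at_iff:
  "G \<in> spectrum_topology closure_of (spectrum_at p) \<longleftrightarrow>
    G \<in> spectrum \<and> (\<forall>F. finite F \<and> F \<subseteq> G \<longrightarrow> (\<exists>H\<in>spectrum. insert p F \<subseteq> H))"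
  (is "?L \<longleftrightarrow> ?R")
proof
  assume L: ?L
  then have G: "G \<in> spectrum" by (simp add: in_closure_of topspace_spectrum_topology)
  have "\<exists>H\<in>spectrum. insert p F \<subseteq> H" if "finite F" "F \<subseteq> G" for F
  proof -
    have "G \<in> {G \<in> spectrum. F \<subseteq> G}" using G that(2) by simp
    with L openin_spectrum_superset[OF that(1)]
    have "\<exists>H. H \<in> spectrum_at p \<and> H \<in> {G \<in> spectrum. F \<subseteq> G}"
      unfolding in_closure_of by meson
    then show ?thesis by (auto simp: spectrum_at_def)
  qed
  with G show ?R by blast
next
  assume R: ?R
  have "\<exists>H. H \<in> spectrum_at p \<and> H \<in> T" if T: "G \<in> T" "openin spectrum_topology T" for T
  proof -
    obtain F where "finite F" "F \<subseteq> G" "\<forall>H\<in>spectrum. F \<subseteq> H \<longrightarrow> H \<in> T"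
      using openin_spectrum_topology_finite[OF T(2,1)] by blast
    moreover from this obtain H where "H \<in> spectrum" "insert p F \<subseteq> H" using R by blast
    ultimately show ?thesis by (auto simp: spectrum_at_def)
  qed
  with R show ?L by (simp add: in_closure_of topspace_spectrum_topology)
qed

theorem proposition7p7:
  fixes p q :: "'a::semilattice_sup"
  assumes "subfit TYPE('a)" and "round_semilattice TYPE('a)"
  shows "rather_below p q \<longleftrightarrow>
    spectrum_topology closure_of (spectrum_at p) \<subseteq> spectrum_at q"
proof
  assume pq: "rather_below p q"
  show "spectrum_topology closure_of (spectrum_at p) \<subseteq> spectrum_at q"
  proof
    fix G assume cl: "G \<in> spectrum_topology closure_of (spectrum_at p)"
    then have G: "G \<in> spectrum" by (simp add: in_closure_spectrum_at_iff)
    have "q \<in> G"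
    proof (rule ccontr)
      assume q: "q \<notin> G"
      \<comment> \<open>Any \<open>s\<close> in \<open>G\<close> serves as test element: as
        \<open>q \<notin> G\<close>, each bound \<open>s \<le> sup f q\<close> forces
        \<open>f\<close> into \<open>G\<close>.\<close>
      obtain s where s: "s \<in> G" using G spectrum_iff by blast
      then have "\<not> s \<le> q" using q G spectrum_upD by blast
      then obtain F where F: "finite F" "far (F \<union> {p})" "\<forall>f\<in>F. s \<le> sup f q"
        using pq unfolding rather_below_def by blast
      then have "F \<subseteq> G" using q s G spectrum_upD spectrum_sup_iff by blast
      then obtain H where "H \<in> spectrum" "F \<union> {p} \<subseteq> H"
        using cl F(1) by (auto simp: in_closure_spectrum_at_iff)
      then show False using F(2) far_not_subset_spectrum by blast
    qed
    then show "G \<in> spectrum_at q" using G by (simp add: spectrum_at_def)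
  qed
next
  assume cl: "spectrum_topology closure_of (spectrum_at p) \<subseteq> spectrum_at q"
  define \<F> where "\<F> = {F. finite F \<and> (\<forall>H\<in>spectrum. \<not> insert p F \<subseteq> H)}"
  \<comment> \<open>A point without \<open>q\<close> lies outside the closure, and a basic
    neighbourhood disjoint from \<open>spectrum_at p\<close> is indexed by a set in
    \<open>\<F>\<close>.\<close>
  have nbhd: "\<exists>F\<in>\<F>. F \<subseteq> G" if "G \<in> spectrum" "q \<notin> G" for G
  proof -
    have "G \<notin> spectrum_topology closure_of (spectrum_at p)"
      using cl that(2) by (auto simp: spectrum_at_def)
    then show ?thesis using that(1) unfolding in_closure_spectrum_at_iff \<F>_def by blast
  qed
  show "rather_below p q"
    unfolding rather_below_def
  proof (intro allI impI)
    fix s assume s: "\<not> s \<le> q"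
    \<comment> \<open>Membership in \<open>ideal_sup {..q} f\<close> amounts to
      \<open>s \<le> sup f q\<close>, phrased to fit \<open>ideal_extension\<close>.\<close>
    have "\<exists>F\<in>\<F>. \<forall>f\<in>F. s \<in> ideal_sup {..q} f"
    proof (rule ccontr)
      assume contra: "\<not> ?thesis"
      have prod: "(\<Union>f\<in>F. sup f ` \<phi> f) \<in> \<F>"
        if F: "F \<in> \<F>" and \<phi>: "\<And>f. f \<in> F \<Longrightarrow> \<phi> f \<in> \<F>" for F \<phi>
      proof -
        have "\<not> insert p (\<Union>f\<in>F. sup f ` \<phi> f) \<subseteq> H" if H: "H \<in> spectrum" for H
        proof
          assume sub: "insert p (\<Union>f\<in>F. sup f ` \<phi> f) \<subseteq> H"
          have "\<not> insert p F \<subseteq> H" using F H by (simp add: \<F>_def)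
          \<comment> \<open>A point omitting \<open>f\<close> but containing \<open>sup f g\<close>
            must contain \<open>g\<close>, so \<open>H\<close> would include all of
            \<open>\<phi> f\<close>.\<close>
          then obtain f where f: "f \<in> F" "f \<notin> H" using sub by blast
          have "\<phi> f \<subseteq> H" using f sub spectrum_sup_iff[OF H] by blast
          moreover have "\<not> insert p (\<phi> f) \<subseteq> H" using \<phi>[OF f(1)] H by (simp add: \<F>_def)
          ultimately show False using sub by blast
        qed
        then show ?thesis using F \<phi> by (auto simp: \<F>_def)
      qed
      obtain G where "G \<in> spectrum" "q \<notin> G" using spectrum_separates[OF assms s] by blast
      then have ne: "\<F> \<noteq> {}" using nbhd by blast
      obtain M where M: "ideal M" "{..q} \<subseteq> M" "s \<notin> M" "\<And>F. F \<in> \<F> \<Longrightarrow> F \<inter> M \<noteq> {}"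
      proof (rule ideal_extension[of "{..q}" \<F> s])
        show "ideal {..q}" by (auto simp: ideal_def)
        show "finite F" if "F \<in> \<F>" for F using that by (simp add: \<F>_def)
        show "\<exists>f\<in>F. s \<notin> ideal_sup {..q} f" if "F \<in> \<F>" for F using contra that by blast
      qed (use ne prod in blast)+
      \<comment> \<open>Since \<open>q\<close> lies in \<open>M\<close>, it is not in
        \<open>G\<close>; \<open>nbhd\<close> then places a member of \<open>\<F>\<close> inside
        \<open>G\<close>, hence disjoint from \<open>M\<close>.\<close>
      obtain G where G: "G \<in> spectrum" "M \<inter> G = {}"
        using round_ideal_subset_spectrum[OF assms(2) M(1)] M(3) by blast
      then show False using nbhd[OF G(1)] M(2,4) by blast
    qed
    then obtain F where F: "F \<in> \<F>" "\<forall>f\<in>F. s \<in> ideal_sup {..q} f" by blast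
    have "far (F \<union> {p})"
      using F(1) by (intro farI_spectrum[OF assms]) (simp_all add: \<F>_def)
    moreover have "s \<le> sup f q" if f: "f \<in> F" for f
    proof -
      obtain k where "k \<le> q" "s \<le> sup k f" using F(2) f unfolding ideal_sup_def by blast
      then show ?thesis by (metis order_refl order_trans sup.commute sup_mono)
    qed
    ultimately show "\<exists>F. finite F \<and> far (F \<union> {p}) \<and> (\<forall>f\<in>F. s \<le> sup f q)"
      using F(1) by (auto simp: \<F>_def)
  qed
qed

end
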